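(* Suppose that every strongly admissible multiset of the form $\{1^a,x^b,y^c\}$ with integers $1<x<y$, $a,b,c\ge 0$, and $a+b\ge y-1$ is realizable. Then every strongly admissible multiset $L$ with $|\mathrm{supp}(L)|=3$ is realizable.
   Context: For a positive integer $v$, $K_v$ is the complete graph on vertex set $\{0,1,\dots,v-1\}$; the length of an edge $\{u,w\}$ is $\min(|u-w|,\,v-|u-w|)$. A multiset $L$ of positive integers of size $v-1$ is realizable if there is a Hamiltonian path in $K_v$ whose multiset of edge lengths equals $L$. $\{x_1^{a_1},\dots,x_k^{a_k}\}$ denotes the multiset containing $x_i$ with multiplicity $a_i$, and $\mathrm{supp}(L)$ is the set of distinct elements of $L$. A multiset $L$ of size $v-1$ is strongly admissible if $\mathrm{supp}(L)\subseteq\{1,2,\dots,\lfloor v/2\rfloor\}$ and $\gcd(v,z)=1$ for every $z\in L$. *)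

theory Defs
  imports "Graph_Theory.Graph_Theory" "HOL-Library.Multiset"
begin

text \<open>The graph library represents an undirected graph as a symmetric digraph.\<close>

definition complete_graph :: "nat \<Rightarrow> nat pair_pre_digraph" where
  "complete_graph v =
     \<lparr> pverts = {0..<v}, parcs = {(u, w). u \<in> {0..<v} \<and> w \<in> {0..<v} \<and> u \<noteq> w} \<rparr>"

lemma complete_graph_is_complete_digraph:
  "complete_digraph v (with_proj (complete_graph v))"
proof -
  have "pair_graph (complete_graph v)"
  proof
    have "parcs (complete_graph v) \<subseteq> {0..<v} \<times> {0..<v}"
      by (auto simp: complete_graph_def)
    then show "finite (parcs (complete_graph v))"
      by (rule finite_subset) simp
  qed (auto simp: complete_graph_def arc_to_ends_def symmetric_def arcs_ends_def intro!: symI)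
  then show ?thesis
    by (auto simp: complete_digraph_pair_def complete_graph_def)
qed

definition hamiltonian_path :: "'a list \<Rightarrow> ('a, 'b) pre_digraph \<Rightarrow> bool" where
  "hamiltonian_path p G \<longleftrightarrow> vpath p G \<and> set p = verts G"

text \<open>The difference is taken in the integers because subtraction on naturals truncates. The
  function is symmetric in its two vertices, so it does not depend on which of the two arcs
  represents an edge.\<close>

definition edge_length :: "nat \<Rightarrow> nat \<times> nat \<Rightarrow> nat" where
  "edge_length v = (\<lambda>(u, w). let d = nat \<bar>int u - int w\<bar> in min d (v - d))"

text \<open>A Hamiltonian path of \<open>complete_graph v\<close> has \<open>v - 1\<close> edges, all of positive length, so
  \<open>realizable v L\<close> entails \<open>size L = v - 1\<close> and the positivity of the elements of \<open>L\<close>.\<close>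

definition realizable :: "nat \<Rightarrow> nat multiset \<Rightarrow> bool" where
  "realizable v L \<longleftrightarrow>
     (\<exists>p. hamiltonian_path p (with_proj (complete_graph v)) \<and>
          image_mset (edge_length v) (mset (vwalk_arcs p)) = L)"

definition strongly_admissible :: "nat \<Rightarrow> nat multiset \<Rightarrow> bool" where
  "strongly_admissible v L \<longleftrightarrow>
     v > 0 \<and> size L = v - 1 \<and> set_mset L \<subseteq> {1..v div 2} \<and> (\<forall>z\<in>#L. gcd v z = 1)"

end

theory Submission
  imports Defs "HOL-Number_Theory.Cong"
begin

text \<open>Multiplication by a unit \<open>k\<close> modulo \<open>v\<close> permutes the vertices and acts on the edge
  lengths, so it preserves realizability. Choosing \<open>k\<close> to be the inverse of the most frequent
  length reduces \<open>L\<close> to a multiset \<open>{1\<^sup>a, x\<^sup>b, y\<^sup>c}\<close> with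
  \<open>a \<ge> b\<close> and \<open>a \<ge> c\<close>. Then \<open>2 * c \<le> v - 1\<close>, and therefore
  \<open>a + b \<ge> (v - 1) / 2 \<ge> y - 1\<close>.\<close>

lemma vwalk_arcs_map: "vwalk_arcs (map f p) = map (map_prod f f) (vwalk_arcs p)"
  by (induction p rule: vwalk_arcs.induct) auto

lemma vwalk_arcs_distinct:
  assumes "distinct p" "(u, w) \<in> set (vwalk_arcs p)"
  shows "u \<in> set p" "w \<in> set p" "u \<noteq> w"
  using assms by (induction p rule: vwalk_arcs.induct) auto

text \<open>Consecutive entries of a distinct list differ, so in a complete graph distinctness
  already makes the list a walk. \<open>p \<noteq> []\<close> matters for
  \<open>v = 0\<close>.\<close>

lemma hamiltonian_path_complete_graph_iff:
  "hamiltonian_path p (with_proj (complete_graph v)) \<longleftrightarrow>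
     p \<noteq> [] \<and> distinct p \<and> set p = {0..<v}"
proof -
  have "arcs_ends (with_proj (complete_graph v)) = {(u, w). u < v \<and> w < v \<and> u \<noteq> w}"
    by (auto simp: arcs_ends_def arc_to_ends_def complete_graph_def)
  moreover have "set (vwalk_arcs p) \<subseteq> {(u, w). u \<in> set p \<and> w \<in> set p \<and> u \<noteq> w}" if "distinct p"
    using vwalk_arcs_distinct[OF that] by blast
  ultimately show ?thesis
    by (auto simp: hamiltonian_path_def vpath_def vwalk_def complete_graph_def)
qed

text \<open>For \<open>v > 0\<close>, the distance from \<open>d\<close> to the nearest multiple of
  \<open>v\<close>. It extends edge length from differences of vertices to arbitrary integers, so
  that differences can be multiplied freely.\<close>

definition residue_length :: "nat \<Rightarrow> int \<Rightarrow> nat" where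
  "residue_length v d = nat (min (d mod int v) (- d mod int v))"

lemma residue_length_minus [simp]: "residue_length v (- d) = residue_length v d"
  by (simp add: residue_length_def min.commute)

lemma residue_length_cong:
  assumes "[d = e] (mod int v)"
  shows "residue_length v d = residue_length v e"
proof -
  have "[- d = - e] (mod int v)"
    using assms by (simp add: cong_minus_minus_iff)
  with assms show ?thesis by (simp add: residue_length_def cong_def)
qed

lemma int_residue_length_cases:
  assumes "v > 0"
  obtains "[int (residue_length v d) = d] (mod int v)"
  | "[int (residue_length v d) = - d] (mod int v)"
proof -
  \<comment> \<open>For positive \<open>v\<close> both residues are nonnegative, so
    \<open>nat\<close> truncates nothing.\<close>
  have "int (residue_length v d) = min (d mod int v) (- d mod int v)"
    using assms by (simp add: residue_length_def)
  then have "int (residue_length v d) = d mod int v \<or> int (residue_length v d) = - d mod int v"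
    by linarith
  then show ?thesis using that by (auto simp: cong_def)
qed

text \<open>Passing from \<open>d\<close> to its length changes \<open>d\<close> modulo
  \<open>v\<close> by at most a sign, which the outer length ignores. Hence multiplication acts on
  lengths, and successive multiplications compose.\<close>

lemma residue_length_mult_residue_length:
  assumes "v > 0"
  shows "residue_length v (k * int (residue_length v d)) = residue_length v (k * d)"
  using assms
proof (cases rule: int_residue_length_cases[of v d])
  case 1
  then show ?thesis by (intro residue_length_cong cong_mult cong_refl)
next
  case 2
  then have "residue_length v (k * int (residue_length v d)) = residue_length v (k * - d)"
    by (intro residue_length_cong cong_mult cong_refl)
  then show ?thesis by simp
qed

lemma residue_length_small:
  assumes "z \<le> v div 2"
  shows "residue_length v (int z) = z"
proof (cases "z = 0")
  case False
  have "- int z mod int v = int v - int z"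
    using assms False by (subst zmod_zminus1_eq_if) auto
  then show ?thesis using assms False by (simp add: residue_length_def)
qed (simp add: residue_length_def)

text \<open>The residues of \<open>d\<close> and \<open>- d\<close> are both zero or sum to
  \<open>v\<close>, so the smaller is at most half of \<open>v\<close>.\<close>

lemma residue_length_le:
  assumes "v > 0"
  shows "residue_length v d \<le> v div 2"
proof -
  have "d mod int v \<ge> 0" "d mod int v < int v" using assms by auto
  then show ?thesis
    by (cases "d mod int v = 0") (auto simp: residue_length_def zmod_zminus1_eq_if)
qed

text \<open>The gcd with \<open>v\<close> is unchanged by a sign or by adding multiples of
  \<open>v\<close>.\<close>

lemma gcd_residue_length:
  assumes "v > 0"
  shows "gcd (int v) (int (residue_length v d)) = gcd (int v) d"
  using assms
proof (cases rule: int_residue_length_cases[of v d])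
  case 1
  then show ?thesis by (metis cong_gcd_eq gcd.commute)
next
  case 2
  then show ?thesis by (metis cong_gcd_eq gcd.commute gcd_neg2)
qed

lemma edge_length_eq_residue_length:
  assumes "u < v" "w < v"
  shows "edge_length v (u, w) = residue_length v (int u - int w)"
proof -
  \<comment> \<open>Both sides are symmetric in \<open>u\<close> and \<open>w\<close>, so one
    ordering suffices.\<close>
  have *: "edge_length v (u, w) = residue_length v (int u - int w)" if "w \<le> u" "u < v" for u w
  proof (cases "u = w")
    case False
    have "- (int u - int w) mod int v = int v - (int u - int w)"
      using that False by (subst zmod_zminus1_eq_if) auto
    then show ?thesis using that False by (auto simp: residue_length_def edge_length_def Let_def)
  qed (simp add: residue_length_def edge_length_def)
  have sym: "edge_length v (u, w) = edge_length v (w, u)"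
    by (simp add: edge_length_def abs_minus_commute)
  show ?thesis
  proof (cases "w \<le> u")
    case True
    then show ?thesis using * assms by simp
  next
    case False
    then show ?thesis
      using *[of u w] assms sym residue_length_minus[of v "int u - int w"] by simp
  qed
qed

text \<open>Relabel each vertex \<open>u\<close> of a realizing path as \<open>k * u mod v\<close>:
  the path stays Hamiltonian, and each difference along it is multiplied by \<open>k\<close> modulo
  \<open>v\<close>.\<close>

lemma realizable_image_mult:
  assumes "coprime v k" "v > 0" "realizable v L"
  shows "realizable v (image_mset (\<lambda>z. residue_length v (int k * int z)) L)"
proof -
  define f where "f u = k * u mod v" for u
  obtain p where p: "p \<noteq> []" "distinct p" "set p = {0..<v}"
    and L: "image_mset (edge_length v) (mset (vwalk_arcs p)) = L"
    using assms(3) by (auto simp: realizable_def hamiltonian_path_complete_graph_iff)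
  have inj: "inj_on f {0..<v}"
  proof (rule inj_onI)
    fix u w assume uw: "u \<in> {0..<v}" "w \<in> {0..<v}" "f u = f w"
    then have "[k * u = k * w] (mod v)" by (simp add: f_def cong_def)
    then have "[u = w] (mod v)"
      using assms(1) by (simp add: cong_mult_lcancel_nat coprime_commute)
    then show "u = w" using uw by (simp add: cong_def)
  qed
  have "f ` {0..<v} \<subseteq> {0..<v}" using assms(2) by (auto simp: f_def)
  then have img: "f ` {0..<v} = {0..<v}" using inj by (intro endo_inj_surj) auto
  have ham: "hamiltonian_path (map f p) (with_proj (complete_graph v))"
    using p inj img by (simp add: hamiltonian_path_complete_graph_iff distinct_map)
  have len: "edge_length v (map_prod f f e) = residue_length v (int k * int (edge_length v e))"
    if "e \<in> set (vwalk_arcs p)" for e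
  proof -
    obtain u w where e: "e = (u, w)" by force
    have uw: "u < v" "w < v" using vwalk_arcs_distinct[OF p(2)] that p(3) e by auto
    have "edge_length v (map_prod f f e) = residue_length v (int (f u) - int (f w))"
      using assms(2) by (simp add: e edge_length_eq_residue_length f_def)
    \<comment> \<open>The reductions inside \<open>f\<close> alter the difference only by a multiple
      of \<open>v\<close>.\<close>
    also have "\<dots> = residue_length v (int k * (int u - int w))"
      by (rule residue_length_cong)
        (simp add: cong_def f_def zmod_int mod_diff_eq right_diff_distrib)
    finally show ?thesis
      using uw assms(2)
      by (simp add: e edge_length_eq_residue_length residue_length_mult_residue_length)
  qed
  have "image_mset (edge_length v) (mset (vwalk_arcs (map f p))) =
      image_mset (\<lambda>z. residue_length v (int k * int z)) L"
    unfolding L[symmetric] vwalk_arcs_map mset_map multiset.map_comp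
    by (rule image_mset_cong) (simp add: len)
  then show ?thesis using ham by (auto simp: realizable_def)
qed

lemma strongly_admissible_iff:
  "strongly_admissible v L \<longleftrightarrow>
     v > 0 \<and> size L = v - 1 \<and> (\<forall>z\<in>#L. 1 \<le> z \<and> z \<le> v div 2 \<and> coprime v z)"
  unfolding strongly_admissible_def coprime_iff_gcd_eq_1 subset_eq atLeastAtMost_iff by blast

lemma strongly_admissible_image_mult:
  assumes "coprime v k" "strongly_admissible v L"
  shows "strongly_admissible v (image_mset (\<lambda>z. residue_length v (int k * int z)) L)"
proof -
  have v: "v > 0" using assms by (simp add: strongly_admissible_def)
  have z: "1 \<le> residue_length v (int k * int z) \<and> gcd v (residue_length v (int k * int z)) = 1"
    if "z \<in># L" for z
  proof -
    have "z \<le> v div 2" "1 \<le> z" "coprime v z"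
      using that assms(2) by (auto simp: strongly_admissible_iff)
    then have "coprime (int v) (int (k * z))" and "v \<noteq> 1"
      using assms(1) by (auto simp: coprime_int_iff)
    then have "gcd (int v) (int (residue_length v (int k * int z))) = 1"
      using gcd_residue_length[OF v] by simp
    then have g: "gcd v (residue_length v (int k * int z)) = 1" by (metis gcd_int_int_eq of_nat_eq_1_iff)
    \<comment> \<open>A zero length would have gcd \<open>v\<close> with \<open>v\<close>, so
      coprimality also yields positivity.\<close>
    with \<open>v \<noteq> 1\<close> show ?thesis by (cases "residue_length v (int k * int z)") auto
  qed
  then show ?thesis using assms(2) v residue_length_le[OF v]
    by (auto simp: strongly_admissible_def)
qed

lemma mset_eq_replicate_triple:
  assumes "set_mset L = {p, q, r}" "p \<noteq> q" "p \<noteq> r" "q \<noteq> r"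
  shows "L = replicate_mset (count L p) p + replicate_mset (count L q) q
    + replicate_mset (count L r) r"
proof (rule multiset_eqI)
  fix z show "count L z = count (replicate_mset (count L p) p + replicate_mset (count L q) q
    + replicate_mset (count L r) r) z"
    using assms by (cases "z \<in># L") (auto simp: count_eq_zero_iff)
qed

theorem theorem2p7:
  fixes v :: nat and L :: "nat multiset"
  assumes hyp: "\<And>v x y a b c :: nat.
      1 < x \<Longrightarrow> x < y \<Longrightarrow> a + b \<ge> y - 1 \<Longrightarrow>
      strongly_admissible v
        (replicate_mset a 1 + replicate_mset b x + replicate_mset c y) \<Longrightarrow>
      realizable v (replicate_mset a 1 + replicate_mset b x + replicate_mset c y)"
    and L: "strongly_admissible v L"
    and supp: "card (set_mset L) = 3"
  shows "realizable v L"
proof -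
  have small: "z \<le> v div 2" and coprime: "coprime v z" if "z \<in># L" for z
    using L that by (auto simp: strongly_admissible_iff)
  have v: "v > 0" and size: "size L = v - 1" using L by (auto simp: strongly_admissible_def)
  have "Max (count L ` set_mset L) \<in> count L ` set_mset L" using supp by (intro Max_in) auto
  then obtain m where m: "m \<in># L" and "count L m = Max (count L ` set_mset L)" by auto
  then have max: "count L z \<le> count L m" if "z \<in># L" for z using that by simp
  \<comment> \<open>\<open>k\<close> inverts the most frequent length \<open>m\<close>, so
    multiplying by \<open>k\<close> turns \<open>m\<close> into 1 and multiplying by
    \<open>m\<close> reverses the change.\<close>
  obtain k where k: "[m * k = 1] (mod v)"
    using coprime[OF m] cong_solve_coprime_nat[of m v] by (auto simp: coprime_commute)
  then have "coprime v k"
    by (metis coprime_commute coprime_iff_invertible_nat mult.commute One_nat_def)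
  define f where "f z = residue_length v (int k * int z)" for z
  define g where "g z = residue_length v (int m * int z)" for z
  \<comment> \<open>The factors \<open>m\<close> and \<open>k\<close> cancel modulo
    \<open>v\<close>, and \<open>z\<close>, being at most \<open>v div 2\<close>, is its own
    length.\<close>
  have gf: "g (f z) = z" if "z \<in># L" for z
  proof -
    have "[int m * (int k * int z) = int z] (mod int v)"
      using cong_mult[OF cong_int_iff[THEN iffD2, OF k] cong_refl[of "int z"]]
      by (simp add: mult.assoc)
    then show ?thesis
      using residue_length_cong residue_length_small[OF small[OF that]]
      by (simp add: f_def g_def residue_length_mult_residue_length[OF v])
  qed
  have inj: "inj_on f (set_mset L)" by (rule inj_on_inverseI[of _ g]) (simp add: gf)
  have gfL: "image_mset g (image_mset f L) = L"
    by (simp add: multiset.map_comp gf cong: image_mset_cong)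
  have adm: "strongly_admissible v (image_mset f L)"
    unfolding f_def by (rule strongly_admissible_image_mult[OF \<open>coprime v k\<close> L])
  have fm: "f m = 1"
  proof -
    have "1 \<le> v div 2" using L m by (force simp: strongly_admissible_def)
    moreover have "[int k * int m = int 1] (mod int v)"
      using cong_int_iff[THEN iffD2, OF k] by (simp add: mult.commute)
    ultimately show ?thesis
      using residue_length_cong residue_length_small by (metis f_def)
  qed
  have "card (set_mset L - {m}) = 2" using supp m by simp
  then obtain x' y' where xy': "set_mset L - {m} = {x', y'}" "x' \<noteq> y'" by (auto simp: card_2_iff)
  \<comment> \<open>The other two lengths are named by the order of their images, since it is
    \<open>f x\<close> and \<open>f y\<close> that enter \<open>hyp\<close>.\<close>
  obtain x y where xy: "set_mset L - {m} = {x, y}" "f x < f y"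
  proof (cases "f x' < f y'")
    case False
    have "x' \<in># L" "y' \<in># L" using xy' by auto
    then have "f x' \<noteq> f y'" using inj xy'(2) by (auto dest: inj_onD)
    then show ?thesis using that[of y' x'] xy' False by auto
  qed (use that xy' in blast)
  have supp_eq: "set_mset L = {m, x, y}" and distinct: "m \<noteq> x" "m \<noteq> y" "x \<noteq> y"
    using xy m by auto
  define a b c where "a = count L m" and "b = count L x" and "c = count L y"
  have L_eq: "L = replicate_mset a m + replicate_mset b x + replicate_mset c y"
    using mset_eq_replicate_triple[OF supp_eq distinct] by (simp add: a_def b_def c_def)
  have fL: "image_mset f L = replicate_mset a 1 + replicate_mset b (f x) + replicate_mset c (f y)"
    by (subst L_eq) (simp add: fm)
  have "f x \<noteq> f m" using inj supp_eq distinct by (auto dest: inj_onD)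
  moreover have "f x \<ge> 1" using adm supp_eq by (auto simp: strongly_admissible_def)
  ultimately have x: "1 < f x" using fm by linarith
  have "a + b + c = v - 1" using size by (subst (asm) L_eq) simp
  moreover have "c \<le> a" using max[of y] supp_eq by (simp add: a_def c_def)
  moreover have "f y \<le> v div 2" by (simp add: f_def residue_length_le v)
  ultimately have "f y - 1 \<le> a + b" by linarith
  then have "realizable v (image_mset f L)"
    using hyp[of "f x" "f y" a b v c] x xy(2) adm by (simp add: fL)
  \<comment> \<open>Multiplication by the unit \<open>m\<close> carries the realization back to
    \<open>L\<close>.\<close>
  then have "realizable v (image_mset g (image_mset f L))"
    unfolding g_def by (rule realizable_image_mult[OF coprime[OF m] v])
  then show ?thesis by (simp only: gfL)
qed

end
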